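(* Let $s\le t$ be positive integers. Every $K_{s,t}$-free bipartite circle graph has a vertex of degree at most $\max\{2s-2,\,t-1\}$.
   Context: Graphs are finite and simple, with at least one vertex. A graph is $F$-free if it has no (not necessarily induced) subgraph isomorphic to $F$. A circle graph is the intersection graph of a finite collection of chords of a circle (vertices are the chords, two being adjacent exactly when the chords intersect). A bipartite circle graph is a circle graph that is bipartite. *)

theory Defs
  imports "HOL-Analysis.Analysis" "Graph_Theory.Kuratowski"
begin

text \<open>
  A finite simple graph is a \<^locale>\<open>graph\<close> of the Graph Theory library: a finite, symmetric
  digraph without loops and parallel arcs. Each edge is a pair of opposite arcs, so
  \<^const>\<open>out_degree\<close> is the ordinary degree of a vertex.
\<close>

definition bipartite :: "('a, 'b) pre_digraph \<Rightarrow> bool" where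
  "bipartite G \<longleftrightarrow>
    (\<exists>A B. verts G = A \<union> B \<and> A \<inter> B = {} \<and> arcs_ends G \<subseteq> A \<times> B \<union> B \<times> A)"

text \<open>
  \<^term>\<open>K\<^bsub>s,t\<^esub> H\<close> describes the complete bipartite graphs up to isomorphism, and
  \<^const>\<open>subgraph\<close> does not require subgraphs to be induced.
\<close>

definition complete_bipartite_free :: "nat \<Rightarrow> nat \<Rightarrow> ('a, 'b) pre_digraph \<Rightarrow> bool" where
  "complete_bipartite_free s t G \<longleftrightarrow> \<not> (\<exists>H. subgraph H G \<and> K\<^bsub>s,t\<^esub> H)"

definition chords :: "complex \<Rightarrow> real \<Rightarrow> complex set set" where
  "chords c r = {closed_segment a b | a b. a \<in> sphere c r \<and> b \<in> sphere c r \<and> a \<noteq> b}"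

text \<open>
  The collection of chords is a family \<^term>\<open>\<phi>\<close> indexed by the vertices. Chords contain their
  endpoints, so chords with a common endpoint intersect; repeated chords are allowed.
\<close>

definition circle_graph :: "('a, 'b) pre_digraph \<Rightarrow> bool" where
  "circle_graph G \<longleftrightarrow> graph G \<and>
    (\<exists>c r \<phi>. r > 0 \<and> \<phi> ` verts G \<subseteq> chords c r \<and>
      (\<forall>u \<in> verts G. \<forall>v \<in> verts G. u \<noteq> v \<longrightarrow>
        (u \<rightarrow>\<^bsub>G\<^esub> v \<longleftrightarrow> \<phi> u \<inter> \<phi> v \<noteq> {})))"

end

theory Submission
  imports Defs
begin

text \<open>
  Let \<^term>\<open>A\<close> and \<^term>\<open>B\<close> be the colour classes, and suppose that every vertex has degree at
  least \<open>2 s - 1\<close> and at least \<^term>\<open>t\<close>. The chords of \<^term>\<open>A\<close> are pairwise disjoint, so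
  they cut the disc into regions that form a tree whose edges are the chords of \<^term>\<open>A\<close>, and a
  chord of \<^term>\<open>B\<close> meets exactly the edges of a path of this tree. Root the tree and consider an
  edge \<open>l\<close> of maximal depth. A path through \<open>l\<close> starts below \<open>l\<close>, first climbs towards the root
  and then descends, and it cannot descend by more edges than it has climbed. As it has at least
  \<open>2 s - 1\<close> edges, it climbs at least \<^term>\<open>s\<close> of them. So the first \<^term>\<open>s\<close> edges on the way
  from \<open>l\<close> to the root lie on each of the at least \<^term>\<open>t\<close> paths through \<open>l\<close>, which gives a
  \<open>K\<^bsub>s,t\<^esub>\<close>.

  The tree itself is never constructed. Its root is a point \<open>p\<close> of the disc that lies on no chord,
  and the edge of a chord is represented by its cap, the part of the disc that the chord separates
  from \<open>p\<close>. Caps of disjoint chords are disjoint or nested (\<open>caps_laminar\<close>), the position of the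
  endpoints of a chord relative to a cap decides whether the two chords meet
  (\<open>segment_meets_slice_iff\<close>), and the counting argument uses nothing else
  (\<open>laminar_caps_biclique\<close>).
\<close>

section \<open>Complete bipartite subgraphs of a laminar family of caps\<close>

text \<open>
  The set \<^term>\<open>H a\<close> is the closed cap of \<^term>\<open>a\<close>, the set \<^term>\<open>I a\<close> is the cap
  without its chord, and \<^term>\<open>x b\<close> and \<^term>\<open>y b\<close> are the endpoints of \<^term>\<open>b\<close>. The
  caps around a point correspond to the path from a region to the root. For a point \<open>z\<close> in the
  largest number of caps, the smallest cap around \<open>z\<close> is the edge \<open>l\<close> of maximal depth. Going
  up the chain of caps around \<open>z\<close>, a \<^term>\<open>b\<close> that is adjacent to \<open>l\<close> remains adjacent until a
  cap contains both its endpoints, and is adjacent to no later cap.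
\<close>

lemma laminar_caps_biclique:
  fixes H I :: "'a \<Rightarrow> 'p set" and x y :: "'b \<Rightarrow> 'p" and R :: "'a \<Rightarrow> 'b \<Rightarrow> bool"
  assumes finA: "finite A" and neA: "A \<noteq> {}"
    and neH: "\<And>a. a \<in> A \<Longrightarrow> H a \<noteq> {}"
    and IH: "\<And>a. a \<in> A \<Longrightarrow> I a \<subseteq> H a"
    and laminar: "\<And>a a'. \<lbrakk>a \<in> A; a' \<in> A; a \<noteq> a'\<rbrakk> \<Longrightarrow>
      H a \<inter> H a' = {} \<or> H a \<subseteq> I a' \<or> H a' \<subseteq> I a"
    and R_iff: "\<And>a b. \<lbrakk>a \<in> A; b \<in> B\<rbrakk> \<Longrightarrow>
      R a b \<longleftrightarrow> \<not> {x b, y b} \<subseteq> I a \<and> {x b, y b} \<inter> H a \<noteq> {}"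
    and degB: "\<And>b. b \<in> B \<Longrightarrow> 2 * s - 2 < card {a \<in> A. R a b}"
    and degA: "\<And>a. a \<in> A \<Longrightarrow> t \<le> card {b \<in> B. R a b}"
    and t: "1 \<le> t"
  obtains S T where "S \<subseteq> A" "T \<subseteq> B" "card S = s" "card T = t"
    "\<And>a b. \<lbrakk>a \<in> S; b \<in> T\<rbrakk> \<Longrightarrow> R a b"
proof -
  define around where "around p = {a \<in> A. p \<in> H a}" for p
  have fin_around: "finite (around p)" for p
    using finA by (simp add: around_def)
  have "\<exists>z. \<forall>p. card (around p) \<le> card (around z)"
    by (rule Lattices_Big.ex_has_greatest_nat[of "\<lambda>_. True" undefined _ "Suc (card A)", simplified])
       (auto simp: around_def less_Suc_eq_le intro!: card_mono finA)
  then obtain z where z: "\<And>p. card (around p) \<le> card (around z)"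
    by blast
  define C where "C = around z"
  have finC: "finite C" and CA: "C \<subseteq> A" and zC: "\<And>a. a \<in> C \<Longrightarrow> z \<in> H a"
    using fin_around by (auto simp: C_def around_def)
  have "C \<noteq> {}"
  proof -
    obtain a p where "a \<in> A" "p \<in> H a" using neA neH by blast
    then have "around p \<noteq> {}" by (auto simp: around_def)
    then show ?thesis
      using z[of p] fin_around[of p] by (auto simp: C_def)
  qed
  have chain: "H a \<subseteq> I a' \<or> H a' \<subseteq> I a" if "a \<in> C" "a' \<in> C" "a \<noteq> a'" for a a'
    using laminar[of a a'] that CA zC by blast
  obtain l where l: "l \<in> C" and least: "\<And>a. a \<in> C \<Longrightarrow> H l \<subseteq> H a"
  proof -
    obtain m where "m \<in> H ` C" and m: "\<forall>X\<in>H ` C. X \<subseteq> m \<longrightarrow> m = X"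
      using finite_has_minimal[of "H ` C"] finC \<open>C \<noteq> {}\<close> by blast
    then obtain l where "l \<in> C" "m = H l" by blast
    moreover have "H l \<subseteq> H a" if "a \<in> C" for a
      using chain[of l a] IH CA that \<open>l \<in> C\<close> m \<open>m = H l\<close> by blast
    ultimately show thesis using that by blast
  qed

  define N where "N = {b \<in> B. R l b}"
  define D where "D b = {a \<in> C. R a b}" for b
  have finD: "finite (D b)" for b
    using finC by (simp add: D_def)
  have NB: "b \<in> B" if "b \<in> N" for b
    using that by (simp add: N_def)
  have inside: "{x b, y b} \<subseteq> I a" if "b \<in> N" "a \<in> C" "\<not> R a b" for a b
  proof -
    have "R l b" using that(1) by (simp add: N_def)
    then have "{x b, y b} \<inter> H l \<noteq> {}" using R_iff NB l CA that(1) by blast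
    then have "{x b, y b} \<inter> H a \<noteq> {}" using least[OF that(2)] by blast
    then show ?thesis using R_iff NB CA that by blast
  qed
  have avoid: "\<not> R a b" if "b \<in> N" "a \<in> C" "{x b, y b} \<subseteq> I a" for a b
    using R_iff NB CA that by blast

  \<comment> \<open>The caps around an endpoint of \<^term>\<open>b\<close> are at most as many as those in \<^term>\<open>C\<close>, and
    those in \<^term>\<open>C\<close> that \<^term>\<open>b\<close> avoids are around both endpoints. So a path climbs at
    least half of its edges.\<close>
  have D_large: "s \<le> card (D b)" if b: "b \<in> N" for b
  proof -
    define U where "U = C - D b"
    have U_around: "U \<subseteq> around p" if "p \<in> {x b, y b}" for p
      using inside[OF b] that IH CA by (fastforce simp: U_def D_def around_def)
    have small: "card (around p - U) \<le> card (D b)" if "p \<in> {x b, y b}" for p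
    proof -
      have "card (around p - U) = card (around p) - card U"
        using U_around[OF that] fin_around[of p] finite_subset by (blast intro: card_Diff_subset)
      also have "\<dots> \<le> card C - card U"
        using z[of p] by (simp add: C_def)
      also have "\<dots> = card (C - U)"
        using finC by (intro card_Diff_subset[symmetric]) (auto simp: U_def)
      also have "C - U = D b"
        by (auto simp: U_def D_def)
      finally show ?thesis .
    qed
    have "{a \<in> A. R a b} \<subseteq> (around (x b) - U) \<union> (around (y b) - U)"
      using R_iff NB[OF b] by (auto simp: U_def D_def around_def)
    then have "card {a \<in> A. R a b} \<le> card ((around (x b) - U) \<union> (around (y b) - U))"
      using fin_around by (intro card_mono) auto
    also have "\<dots> \<le> card (around (x b) - U) + card (around (y b) - U)"
      by (rule card_Un_le)
    also have "\<dots> \<le> 2 * card (D b)"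
      using small[of "x b"] small[of "y b"] by simp
    finally show ?thesis
      using degB[OF NB[OF b]] by linarith
  qed

  have "t \<le> card N"
    using degA l CA by (auto simp: N_def)
  then have "N \<noteq> {}"
    using t by auto
  then obtain b0 where b0: "b0 \<in> N" and shortest: "\<And>b. b \<in> N \<Longrightarrow> card (D b0) \<le> card (D b)"
    using ex_has_least_nat[of "\<lambda>b. b \<in> N" _ "\<lambda>b. card (D b)"] by blast
  \<comment> \<open>Each \<^term>\<open>D b\<close> is an initial segment of the chain \<^term>\<open>C\<close>, so the shortest one is
    contained in all others.\<close>
  have common: "D b0 \<subseteq> D b" if b: "b \<in> N" for b
  proof (rule ccontr)
    assume "\<not> D b0 \<subseteq> D b"
    then obtain u where u: "u \<in> C" "R u b0" "\<not> R u b" by (auto simp: D_def)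
    have "a \<in> D b0" if a: "a \<in> C" "R a b" for a
    proof (rule ccontr)
      assume "a \<notin> D b0"
      then have "\<not> R a b0" using a by (simp add: D_def)
      have "H a \<subseteq> I u"
        using chain[of a u] inside[OF b u(1) u(3)] avoid[OF b a(1)] a u IH CA by blast
      then have "{x b0, y b0} \<subseteq> I u"
        using inside[OF b0 a(1) \<open>\<not> R a b0\<close>] IH CA a(1) by blast
      then show False
        using avoid[OF b0 u(1)] u(2) by blast
    qed
    then have "D b \<subset> D b0"
      using u by (auto simp: D_def)
    then have "card (D b) < card (D b0)"
      using finD by (rule psubset_card_mono[rotated])
    then show False
      using shortest[OF b] by simp
  qed
  obtain S where "S \<subseteq> D b0" "card S = s"
    using D_large[OF b0] obtain_subset_with_card_n by metis
  moreover obtain T where "T \<subseteq> N" "card T = t"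
    using \<open>t \<le> card N\<close> obtain_subset_with_card_n by metis
  moreover have "R a b" if "a \<in> S" "b \<in> T" for a b
  proof -
    have "a \<in> D b" using that \<open>S \<subseteq> D b0\<close> \<open>T \<subseteq> N\<close> common by blast
    then show ?thesis by (simp add: D_def)
  qed
  moreover have "S \<subseteq> A" "T \<subseteq> B"
    using \<open>S \<subseteq> D b0\<close> \<open>T \<subseteq> N\<close> CA by (auto simp: D_def N_def)
  ultimately show thesis
    using that by blast
qed

section \<open>Caps of a convex set\<close>

lemma convex_avoiding_hyperplane:
  fixes n :: "'a::euclidean_space"
  assumes "convex S" and "\<And>z. z \<in> S \<Longrightarrow> n \<bullet> z \<noteq> e"
  shows "(\<forall>z\<in>S. n \<bullet> z < e) \<or> (\<forall>z\<in>S. e < n \<bullet> z)"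
proof (rule ccontr)
  assume "\<not> ?thesis"
  then obtain u v where uv: "u \<in> S" "v \<in> S" "e \<le> n \<bullet> u" "n \<bullet> v \<le> e"
    by (auto simp: not_less)
  have "\<exists>z\<in>S. n \<bullet> z = e"
    using connected_ivt_hyperplane[OF convex_connected[OF assms(1)] uv(2,1,4,3)] .
  then show False using assms(2) by blast
qed

lemma segment_meets_slice_iff:
  fixes n :: "'a::euclidean_space"
  assumes "convex K" and "x \<in> K" and "y \<in> K"
  shows "closed_segment x y \<inter> {z \<in> K. n \<bullet> z = e} \<noteq> {} \<longleftrightarrow>
    \<not> {x, y} \<subseteq> {z \<in> K. e < n \<bullet> z} \<and> {x, y} \<inter> {z \<in> K. e \<le> n \<bullet> z} \<noteq> {}"
    (is "?meets \<longleftrightarrow> ?ends")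
proof
  have "closed_segment x y \<subseteq> K"
    using assms by (simp add: closed_segment_subset)
  show ?ends if meets: ?meets
  proof -
    obtain z where z: "z \<in> closed_segment x y" "n \<bullet> z = e"
      using meets by blast
    have "\<not> (e < n \<bullet> x \<and> e < n \<bullet> y)"
      using closed_segment_subset[of x "{z. n \<bullet> z > e}" y] convex_halfspace_gt z by blast
    moreover have "\<not> (n \<bullet> x < e \<and> n \<bullet> y < e)"
      using closed_segment_subset[of x "{z. n \<bullet> z < e}" y] convex_halfspace_lt z by blast
    ultimately show ?ends
      using assms by auto
  qed
  show ?meets if ?ends
  proof (rule ccontr)
    assume "\<not> ?meets"
    then have "n \<bullet> z \<noteq> e" if "z \<in> closed_segment x y" for z
      using that \<open>closed_segment x y \<subseteq> K\<close> by blast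
    then have "(n \<bullet> x < e \<and> n \<bullet> y < e) \<or> (e < n \<bullet> x \<and> e < n \<bullet> y)"
      using convex_avoiding_hyperplane[OF convex_closed_segment] by blast
    then show False
      using \<open>?ends\<close> assms by auto
  qed
qed

text \<open>
  The first slice is convex, so it lies on one side of the second. The part of \<^term>\<open>K\<close> on the
  other side, including the second slice, is convex as well and misses the first slice, so it lies on
  one side of the first. The common point \<^term>\<open>p\<close> outside both caps excludes the fourth
  combination, in which the caps overlap and together cover \<^term>\<open>K\<close>.
\<close>

lemma caps_laminar:
  fixes n n' :: "'a::euclidean_space"
  assumes K: "convex K" and p: "p \<in> K" "n \<bullet> p < e" "n' \<bullet> p < e'"
    and disjoint: "{z \<in> K. n \<bullet> z = e} \<inter> {z \<in> K. n' \<bullet> z = e'} = {}"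
  shows "{z \<in> K. e \<le> n \<bullet> z} \<inter> {z \<in> K. e' \<le> n' \<bullet> z} = {} \<or>
    {z \<in> K. e \<le> n \<bullet> z} \<subseteq> {z \<in> K. e' < n' \<bullet> z} \<or>
    {z \<in> K. e' \<le> n' \<bullet> z} \<subseteq> {z \<in> K. e < n \<bullet> z}"
proof -
  have "convex (K \<inter> {z. n \<bullet> z = e})"
    using K by (intro convex_Int convex_hyperplane)
  then consider "\<forall>z\<in>K \<inter> {z. n \<bullet> z = e}. n' \<bullet> z < e'" | "\<forall>z\<in>K \<inter> {z. n \<bullet> z = e}. e' < n' \<bullet> z"
    using convex_avoiding_hyperplane[of "K \<inter> {z. n \<bullet> z = e}" n' e'] disjoint by blast
  then show ?thesis
  proof cases
    case 1
    have "convex (K \<inter> {z. e' \<le> n' \<bullet> z})"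
      using K convex_halfspace_ge by (intro convex_Int) auto
    moreover have "n \<bullet> z \<noteq> e" if "z \<in> K \<inter> {z. e' \<le> n' \<bullet> z}" for z
      using 1 that by force
    ultimately consider "\<forall>z\<in>K \<inter> {z. e' \<le> n' \<bullet> z}. n \<bullet> z < e"
      | "\<forall>z\<in>K \<inter> {z. e' \<le> n' \<bullet> z}. e < n \<bullet> z"
      using convex_avoiding_hyperplane by blast
    then show ?thesis by cases force+
  next
    case 2
    have "convex (K \<inter> {z. n' \<bullet> z \<le> e'})"
      using K by (intro convex_Int convex_halfspace_le)
    moreover have "n \<bullet> z \<noteq> e" if "z \<in> K \<inter> {z. n' \<bullet> z \<le> e'}" for z
      using 2 that by force
    moreover have "p \<in> K \<inter> {z. n' \<bullet> z \<le> e'}" "\<not> e < n \<bullet> p"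
      using p by auto
    ultimately have below: "\<forall>z\<in>K \<inter> {z. n' \<bullet> z \<le> e'}. n \<bullet> z < e"
      using convex_avoiding_hyperplane by blast
    have "{z \<in> K. e \<le> n \<bullet> z} \<subseteq> {z \<in> K. e' < n' \<bullet> z}"
      using below by (force simp: not_less)
    then show ?thesis by blast
  qed
qed

section \<open>Chords of a circle\<close>

lemma chord_eq_slice:
  fixes a b c :: complex
  assumes a: "a \<in> sphere c r" and b: "b \<in> sphere c r" and "a \<noteq> b"
  shows "closed_segment a b = {z \<in> cball c r. (\<i> * (b - a)) \<bullet> z = (\<i> * (b - a)) \<bullet> a}"
    (is "_ = ?S")
proof
  have "convex (cball c r \<inter> {z. (\<i> * (b - a)) \<bullet> z = (\<i> * (b - a)) \<bullet> a})"
    by (intro convex_Int convex_cball convex_hyperplane)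
  moreover have "(\<i> * (b - a)) \<bullet> b = (\<i> * (b - a)) \<bullet> a"
    by (simp add: inner_complex_def algebra_simps)
  ultimately show "closed_segment a b \<subseteq> ?S"
    using closed_segment_subset[of a "cball c r \<inter> {z. (\<i> * (b - a)) \<bullet> z = (\<i> * (b - a)) \<bullet> a}" b] a b
    by auto
next
  \<comment> \<open>A point outside the segment but on its line would have one of the endpoints strictly between
    itself and the other endpoint, and this endpoint would then be closer to the centre than
    \<^term>\<open>r\<close>.\<close>
  have closer: "\<not> between (z, v) u"
    if "u \<in> sphere c r" "v \<in> sphere c r" "z \<in> cball c r" "u \<noteq> z" "u \<noteq> v" for u v z
  proof
    assume "between (z, v) u"
    then have "u \<in> open_segment z v"
      using that by (simp add: between_mem_segment open_segment_def)
    from dist_decreases_open_segment[OF this, of c] that show False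
      by (auto simp: dist_commute)
  qed
  show "?S \<subseteq> closed_segment a b"
  proof
    fix z assume z: "z \<in> ?S"
    have "Im ((z - a) / (b - a)) = 0"
      using z by (simp add: Im_divide inner_complex_def algebra_simps)
    then have "(z - a) / (b - a) = of_real (Re ((z - a) / (b - a)))"
      by (simp add: complex_eq_iff)
    then have "z - a = of_real (Re ((z - a) / (b - a))) * (b - a)"
      using \<open>a \<noteq> b\<close> by (metis divide_eq_eq right_minus_eq)
    then have "\<exists>u. z = u *\<^sub>R a + (1 - u) *\<^sub>R b"
      by (intro exI[of _ "1 - Re ((z - a) / (b - a))"]) (simp add: scaleR_conv_of_real algebra_simps)
    then have "collinear {a, b, z}"
      by (metis collinear_3_expand insert_commute)
    then show "z \<in> closed_segment a b"
      using closer[of a b z] closer[of b a z] a b z \<open>a \<noteq> b\<close>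
      by (auto simp: collinear_between_cases between_mem_segment closed_segment_commute)
  qed
qed

text \<open>The normal vector is oriented such that \<^term>\<open>p\<close> is not in the cap of the chord.\<close>

lemma chord_cap:
  assumes "X \<in> chords c r" and "p \<in> cball c r" and "p \<notin> X"
  obtains n :: complex and e where "X = {z \<in> cball c r. n \<bullet> z = e}" and "n \<bullet> p < e"
proof -
  obtain a b where ab: "a \<in> sphere c r" "b \<in> sphere c r" "a \<noteq> b" "X = closed_segment a b"
    using assms(1) by (auto simp: chords_def)
  define n where "n = \<i> * (b - a)"
  have X: "X = {z \<in> cball c r. n \<bullet> z = n \<bullet> a}"
    using chord_eq_slice[OF ab(1-3)] ab(4) by (simp add: n_def)
  then have "n \<bullet> p \<noteq> n \<bullet> a" using assms by blast
  then show thesis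
    using that[of n "n \<bullet> a"] that[of "- n" "- (n \<bullet> a)"] X by fastforce
qed

lemma infinite_circle:
  fixes c :: complex
  assumes "r > 0"
  shows "infinite (sphere c r)"
proof
  assume "finite (sphere c r)"
  moreover have "Topological_Spaces.connected (sphere c r)"
    by (rule connected_sphere) simp
  ultimately have "sphere c r = {} \<or> (\<exists>w. sphere c r = {w})"
    by (simp only: connected_finite_iff_sing)
  moreover have "c + of_real r \<in> sphere c r" "c - of_real r \<in> sphere c r"
    using assms by (auto simp: dist_norm)
  ultimately have "c + of_real r = c - of_real r" by (metis empty_iff singletonD)
  then show False using assms by (simp add: complex_eq_iff)
qed

lemma chord_Int_circle:
  fixes a b c :: "'a::euclidean_space"
  assumes "a \<in> sphere c r" and "b \<in> sphere c r"
  shows "closed_segment a b \<inter> sphere c r \<subseteq> {a, b}"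
  using assms dist_decreases_open_segment[of _ a b c]
  by (fastforce simp: open_segment_def dist_commute)

lemma point_off_chords:
  assumes "r > 0" and "finite \<X>" and "\<X> \<subseteq> chords c r"
  obtains p where "p \<in> cball c r" and "\<And>X. X \<in> \<X> \<Longrightarrow> p \<notin> X"
proof -
  have "finite (X \<inter> sphere c r)" if X: "X \<in> \<X>" for X
  proof -
    obtain a b where "a \<in> sphere c r" "b \<in> sphere c r" "X = closed_segment a b"
      using assms(3) X unfolding chords_def by blast
    then show ?thesis using chord_Int_circle[of a c r b] finite_subset by blast
  qed
  then have "finite (\<Union>X\<in>\<X>. X \<inter> sphere c r)"
    using assms(2) by blast
  then obtain p where "p \<in> sphere c r" "p \<notin> (\<Union>X\<in>\<X>. X \<inter> sphere c r)"
    using infinite_circle[OF assms(1)] by (meson finite_subset subsetI)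
  then show thesis using that[of p] by auto
qed

section \<open>Degrees and complete bipartite subgraphs\<close>

lemma (in digraph) out_degree_eq_card_neighbours:
  "out_degree G v = card {w. v \<rightarrow> w}"
proof -
  have "{w. v \<rightarrow> w} = head G ` out_arcs G v"
    by (auto simp: arcs_ends_conv out_arcs_def)
  moreover have "inj_on (head G) (out_arcs G v)"
    using no_multi_arcs by (auto simp: inj_on_def out_arcs_def arc_to_ends_def)
  ultimately show ?thesis
    by (simp add: out_degree_def card_image)
qed

lemma (in graph) biclique_not_complete_bipartite_free:
  assumes "S \<subseteq> verts G" and "T \<subseteq> verts G" and "S \<inter> T = {}"
    and "\<And>a b. \<lbrakk>a \<in> S; b \<in> T\<rbrakk> \<Longrightarrow> a \<rightarrow> b"
  shows "\<not> complete_bipartite_free (card S) (card T) G"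
proof -
  define H where "H = \<lparr>verts = S \<union> T,
    arcs = {e \<in> arcs G. (tail G e, head G e) \<in> S \<times> T \<union> T \<times> S}, tail = tail G, head = head G\<rparr>"
  have ends: "arcs_ends H = S \<times> T \<union> T \<times> S"
  proof
    have "(u, v) \<in> arcs_ends G" if "(u, v) \<in> S \<times> T \<union> T \<times> S" for u v
      using that assms(4) arcs_ends_symmetric[OF sym_arcs] by blast
    then show "S \<times> T \<union> T \<times> S \<subseteq> arcs_ends H"
      by (force simp: H_def arcs_ends_conv)
  qed (auto simp: H_def arcs_ends_conv)
  have "finite S" "finite T"
    using assms finite_subset finite_verts by blast+
  then have "digraph H"
    using no_loops no_multi_arcs
    by unfold_locales (auto simp: H_def arc_to_ends_def)
  then interpret H: digraph H .
  have "symmetric H"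
    by (auto simp: symmetric_def ends sym_def)
  then have "graph H" by (rule H.graphI)
  then have "K\<^bsub>card S,card T\<^esub> H"
    unfolding complete_bipartite_digraph_def using ends assms(3) by (auto simp: H_def)
  moreover have "subgraph H G"
    using assms wf_digraph H.wf_digraph by (auto simp: subgraph_def compatible_def H_def)
  ultimately show ?thesis
    by (auto simp: complete_bipartite_free_def)
qed

section \<open>Vertices of small degree\<close>

theorem theorem2:
  fixes G :: "('a, 'b) pre_digraph" and s t :: nat
  assumes "1 \<le> s" and "s \<le> t"
    and "graph G" and "verts G \<noteq> {}"
    and "bipartite G" and "circle_graph G"
    and "complete_bipartite_free s t G"
  shows "\<exists>v \<in> verts G. out_degree G v \<le> max (2 * s - 2) (t - 1)"
proof (rule ccontr)
  assume "\<not> ?thesis"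
  then have large: "2 * s - 2 < out_degree G v" "t \<le> out_degree G v" if "v \<in> verts G" for v
    using that by (auto simp: not_le)
  interpret graph G by fact
  obtain A B where AB: "verts G = A \<union> B" "A \<inter> B = {}" "arcs_ends G \<subseteq> A \<times> B \<union> B \<times> A"
    using \<open>bipartite G\<close> by (auto simp: bipartite_def)
  have sym: "u \<rightarrow>\<^bsub>G\<^esub> v \<longleftrightarrow> v \<rightarrow>\<^bsub>G\<^esub> u" for u v
    using arcs_ends_symmetric[OF sym_arcs] by blast
  have finA: "finite A"
    using AB(1) finite_verts by (metis finite_Un)
  have degA: "out_degree G a = card {b \<in> B. a \<rightarrow>\<^bsub>G\<^esub> b}" if "a \<in> A" for a
    unfolding out_degree_eq_card_neighbours using AB that by (intro arg_cong[of _ _ card]) blast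
  have degB: "out_degree G b = card {a \<in> A. a \<rightarrow>\<^bsub>G\<^esub> b}" if "b \<in> B" for b
    unfolding out_degree_eq_card_neighbours using AB that sym
    by (intro arg_cong[of _ _ card]) blast
  have "A \<noteq> {}"
  proof
    assume "A = {}"
    then obtain b where "b \<in> B" using AB \<open>verts G \<noteq> {}\<close> by blast
    then show False
      using degB[of b] large(1)[of b] AB \<open>A = {}\<close> by simp
  qed

  obtain c r \<phi> where "r > 0" and \<phi>: "\<phi> ` verts G \<subseteq> chords c r"
    and meets: "\<And>u v. \<lbrakk>u \<in> verts G; v \<in> verts G; u \<noteq> v\<rbrakk> \<Longrightarrow>
      u \<rightarrow>\<^bsub>G\<^esub> v \<longleftrightarrow> \<phi> u \<inter> \<phi> v \<noteq> {}"
    using \<open>circle_graph G\<close> by (auto simp: circle_graph_def)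
  obtain p where p: "p \<in> cball c r" "\<And>v. v \<in> verts G \<Longrightarrow> p \<notin> \<phi> v"
    using point_off_chords[OF \<open>r > 0\<close> _ \<phi>] finite_verts by (metis finite_imageI imageI)
  have "\<exists>n e. \<phi> v = {z \<in> cball c r. n \<bullet> z = e} \<and> n \<bullet> p < e" if "v \<in> verts G" for v
  proof -
    have "\<phi> v \<in> chords c r" using \<phi> that by blast
    then show ?thesis
      by (rule chord_cap[OF _ p(1) p(2)[OF that]]) blast
  qed
  then obtain n e where slice: "\<And>v. v \<in> verts G \<Longrightarrow> \<phi> v = {z \<in> cball c r. n v \<bullet> z = e v}"
    and np: "\<And>v. v \<in> verts G \<Longrightarrow> n v \<bullet> p < e v"
    by metis
  have "\<exists>x y. x \<in> cball c r \<and> y \<in> cball c r \<and> \<phi> v = closed_segment x y" if "v \<in> verts G" for v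
  proof -
    have "\<phi> v \<in> chords c r" using \<phi> that by blast
    then obtain x y where "x \<in> sphere c r" "y \<in> sphere c r" "\<phi> v = closed_segment x y"
      unfolding chords_def by blast
    then show ?thesis
      using sphere_cball by blast
  qed
  then obtain x y where xy: "\<And>v. v \<in> verts G \<Longrightarrow> x v \<in> cball c r"
    "\<And>v. v \<in> verts G \<Longrightarrow> y v \<in> cball c r" "\<And>v. v \<in> verts G \<Longrightarrow> \<phi> v = closed_segment (x v) (y v)"
    by metis

  obtain S T where ST: "S \<subseteq> A" "T \<subseteq> B" "card S = s" "card T = t"
    "\<And>a b. \<lbrakk>a \<in> S; b \<in> T\<rbrakk> \<Longrightarrow> a \<rightarrow>\<^bsub>G\<^esub> b"
  proof (rule laminar_caps_biclique[where A = A and B = B and s = s and t = t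
        and R = "\<lambda>a b. a \<rightarrow>\<^bsub>G\<^esub> b" and x = x and y = y
        and H = "\<lambda>v. {z \<in> cball c r. e v \<le> n v \<bullet> z}" and I = "\<lambda>v. {z \<in> cball c r. e v < n v \<bullet> z}"])
    show "{z \<in> cball c r. e a \<le> n a \<bullet> z} \<noteq> {}" if "a \<in> A" for a
    proof -
      have "x a \<in> \<phi> a" using xy(3) AB that by simp
      then show ?thesis using slice[of a] AB that by fastforce
    qed
    show "{z \<in> cball c r. e a \<le> n a \<bullet> z} \<inter> {z \<in> cball c r. e a' \<le> n a' \<bullet> z} = {} \<or>
      {z \<in> cball c r. e a \<le> n a \<bullet> z} \<subseteq> {z \<in> cball c r. e a' < n a' \<bullet> z} \<or>
      {z \<in> cball c r. e a' \<le> n a' \<bullet> z} \<subseteq> {z \<in> cball c r. e a < n a \<bullet> z}"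
      if "a \<in> A" "a' \<in> A" "a \<noteq> a'" for a a'
    proof (rule caps_laminar[OF convex_cball p(1)])
      have "\<not> a \<rightarrow>\<^bsub>G\<^esub> a'" using that AB by blast
      then show "{z \<in> cball c r. n a \<bullet> z = e a} \<inter> {z \<in> cball c r. n a' \<bullet> z = e a'} = {}"
        using meets[of a a'] slice[of a] slice[of a'] that AB by simp
    qed (use np that AB in auto)
    show "a \<rightarrow>\<^bsub>G\<^esub> b \<longleftrightarrow> \<not> {x b, y b} \<subseteq> {z \<in> cball c r. e a < n a \<bullet> z} \<and>
        {x b, y b} \<inter> {z \<in> cball c r. e a \<le> n a \<bullet> z} \<noteq> {}" if "a \<in> A" "b \<in> B" for a b
    proof -
      have "a \<in> verts G" "b \<in> verts G" "a \<noteq> b" using that AB by auto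
      then have "a \<rightarrow>\<^bsub>G\<^esub> b \<longleftrightarrow> closed_segment (x b) (y b) \<inter> {z \<in> cball c r. n a \<bullet> z = e a} \<noteq> {}"
        using meets[of a b] slice[of a] xy(3)[of b] by (simp add: Int_commute)
      also have "\<dots> \<longleftrightarrow> \<not> {x b, y b} \<subseteq> {z \<in> cball c r. e a < n a \<bullet> z} \<and>
        {x b, y b} \<inter> {z \<in> cball c r. e a \<le> n a \<bullet> z} \<noteq> {}"
        using xy(1,2)[OF \<open>b \<in> verts G\<close>] by (rule segment_meets_slice_iff[OF convex_cball])
      finally show ?thesis .
    qed
    show "2 * s - 2 < card {a \<in> A. a \<rightarrow>\<^bsub>G\<^esub> b}" if "b \<in> B" for b
      using large(1)[of b] degB that AB by simp
    show "t \<le> card {b \<in> B. a \<rightarrow>\<^bsub>G\<^esub> b}" if "a \<in> A" for a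
      using large(2)[of a] degA that AB by simp
  qed (use finA \<open>A \<noteq> {}\<close> \<open>1 \<le> s\<close> \<open>s \<le> t\<close> in auto)
  then have "\<not> complete_bipartite_free (card S) (card T) G"
    using AB by (intro biclique_not_complete_bipartite_free) auto
  then show False
    using \<open>complete_bipartite_free s t G\<close> ST by simp
qed

end
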